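(* Let $\mathcal{C}$ be a category with chosen pushouts, let $(\mathcal{E}, \mathcal{M})$ be an orthogonal factorisation system on $\mathcal{C}$, and let $(M, \iota)$ be an idempotent comonad on $\mathcal{C}$ such that $M \colon \mathcal{C} \to \mathcal{C}$ preserves pushouts. Let $R$, $\eta$ and $\mu$ be the data constructed from these in the context. Then the triple $(R, \eta, \mu)$ is a monad on $\mathcal{C}^{\mathbf{2}}$.
   Context: Orthogonal factorisation system: two classes $\mathcal{E}, \mathcal{M}$ of morphisms of $\mathcal{C}$, both containing the isomorphisms and closed under composition, such that every morphism factors as $m \circ e$ with $e \in \mathcal{E}$, $m \in \mathcal{M}$, and such that for every commutative square $m \circ f = g \circ e$ with $e \in \mathcal{E}$, $m \in \mathcal{M}$ there is a unique $h$ with $h \circ e = f$ and $m \circ h = g$. A choice of $(\mathcal{E},\mathcal{M})$-factorisations is fixed. $(M,\iota)$ denotes an idempotent comonad with counit $\iota \colon M \Rightarrow 1$, so that each $M\iota_A$ is invertible. $\mathcal{C}^{\mathbf{2}}$ is the arrow category: objects are morphisms of $\mathcal{C}$; a morphism $\langle h, k\rangle \colon f \to g$, for $f \colon A \to B$ and $g \colon C \to D$, is a pair $h \colon A \to C$, $k \colon B \to D$ with $k \circ f = g \circ h$. Construction of $T$ and $\nu$. For $f \colon A \to B$, let $f \circ \iota_A = Tf \circ Sf$ be the chosen factorisation, with $Sf \colon MA \to Jf$ in $\mathcal{E}$ and $Tf \colon Jf \to B$ in $\mathcal{M}$. For $\langle h,k \rangle \colon f \to g$, $J\langle h,k\rangle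 \colon Jf \to Jg$ is the unique morphism with $J\langle h,k\rangle \circ Sf = Sg \circ Mh$ and $Tg \circ J\langle h,k\rangle = k \circ Tf$. Let $\nu_f \colon JTf \to Jf$ be the unique morphism with $\nu_f \circ STf = \iota_{Jf}$ and $Tf \circ \nu_f = T^2 f$. Construction of $R$. For $f \colon A \to B$, let $Ef$ be the chosen pushout of $\iota_A \colon MA \to A$ and $Sf \colon MA \to Jf$, with injections $Lf \colon A \to Ef$ and $\alpha_f \colon Jf \to Ef$, and let $Rf \colon Ef \to B$ be the unique morphism with $Rf \circ Lf = f$ and $Rf \circ \alpha_f = Tf$. For $\langle h,k\rangle \colon f \to g$, $E\langle h,k\rangle \colon Ef \to Eg$ is the unique morphism with $E\langle h,k\rangle \circ Lf = Lg \circ h$ and $E\langle h,k\rangle \circ \alpha_f = \alpha_g \circ J\langle h,k\rangle$, and $R\langle h,k\rangle = \langle E\langle h,k\rangle, k\rangle$. Unit and multiplication: $\eta \colon 1 \Rightarrow R$ has components $\eta_f = \langle Lf, 1_B\rangle \colon f \to Rf$. Since $M\alpha_f$ is invertible, so is $J\langle \alpha_f, 1_B\rangle \colon JTf \to JRf$. Let $\mu_f \colon ERf \to Ef$ be the unique morphism with $\mu_f \circ LRf = 1_{Ef}$ and $\mu_f \circ \alpha_{Rf} = \alpha_f \circ \nu_f \circ J\langle \alpha_f, 1_B\rangle^{-1}$; the component of $\mu \colon R^2 \Rightarrow R$ at $f$ is $\langle \mu_f, 1_B\rangle$. *)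

theory Defs
  imports Main
begin

record ('o, 'a) cat =
  Obj :: "'o set"
  Arr :: "'a set"
  Dom :: "'a \<Rightarrow> 'o"
  Cod :: "'a \<Rightarrow> 'o"
  Id :: "'o \<Rightarrow> 'a"
  Comp :: "'a \<Rightarrow> 'a \<Rightarrow> 'a"  (infixr "\<cdot>\<index>" 70)

definition hom :: "('o, 'a, 'm) cat_scheme \<Rightarrow> 'o \<Rightarrow> 'o \<Rightarrow> 'a set" where
  "hom C A B = {f \<in> Arr C. Dom C f = A \<and> Cod C f = B}"

text \<open>\<open>g \<cdot> f\<close> is \<open>g\<close> after \<open>f\<close>; it is only meaningful when \<open>Dom C g = Cod C f\<close>.\<close>

locale category =
  fixes C :: "('o, 'a, 'm) cat_scheme" (structure)
  assumes Dom_in_Obj: "f \<in> Arr C \<Longrightarrow> Dom C f \<in> Obj C"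
    and Cod_in_Obj: "f \<in> Arr C \<Longrightarrow> Cod C f \<in> Obj C"
    and Id_in_hom: "A \<in> Obj C \<Longrightarrow> Id C A \<in> hom C A A"
    and Comp_in_hom: "f \<in> hom C A B \<Longrightarrow> g \<in> hom C B D \<Longrightarrow> g \<cdot> f \<in> hom C A D"
    and Comp_Id: "f \<in> hom C A B \<Longrightarrow> f \<cdot> Id C A = f"
    and Id_Comp: "f \<in> hom C A B \<Longrightarrow> Id C B \<cdot> f = f"
    and Comp_assoc: "f \<in> hom C A B \<Longrightarrow> g \<in> hom C B D \<Longrightarrow> h \<in> hom C D K \<Longrightarrow>
      (h \<cdot> g) \<cdot> f = h \<cdot> (g \<cdot> f)"

definition inverse_arrows :: "('o, 'a, 'm) cat_scheme \<Rightarrow> 'a \<Rightarrow> 'a \<Rightarrow> bool" where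
  "inverse_arrows C f g \<longleftrightarrow>
     f \<in> Arr C \<and> g \<in> hom C (Cod C f) (Dom C f) \<and>
     g \<cdot>\<^bsub>C\<^esub> f = Id C (Dom C f) \<and> f \<cdot>\<^bsub>C\<^esub> g = Id C (Cod C f)"

definition iso :: "('o, 'a, 'm) cat_scheme \<Rightarrow> 'a \<Rightarrow> bool" where
  "iso C f \<longleftrightarrow> (\<exists>g. inverse_arrows C f g)"

definition inv_arrow :: "('o, 'a, 'm) cat_scheme \<Rightarrow> 'a \<Rightarrow> 'a" where
  "inv_arrow C f = (THE g. inverse_arrows C f g)"

record ('o, 'a, 'p, 'b) fmap =
  obj_map :: "'o \<Rightarrow> 'p"
  arr_map :: "'a \<Rightarrow> 'b"

definition id_fmap :: "('o, 'a, 'o, 'a) fmap" where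
  "id_fmap = \<lparr>obj_map = (\<lambda>A. A), arr_map = (\<lambda>f. f)\<rparr>"

definition comp_fmap :: "('p, 'b, 'q, 'c) fmap \<Rightarrow> ('o, 'a, 'p, 'b) fmap \<Rightarrow> ('o, 'a, 'q, 'c) fmap" where
  "comp_fmap G F = \<lparr>obj_map = obj_map G \<circ> obj_map F, arr_map = arr_map G \<circ> arr_map F\<rparr>"

locale functor_between = C: category C + D: category D
  for C :: "('o, 'a, 'm) cat_scheme" and D :: "('p, 'b, 'n) cat_scheme" +
  fixes F :: "('o, 'a, 'p, 'b) fmap"
  assumes obj_map_in_Obj: "A \<in> Obj C \<Longrightarrow> obj_map F A \<in> Obj D"
    and arr_map_in_hom: "f \<in> hom C A B \<Longrightarrow> arr_map F f \<in> hom D (obj_map F A) (obj_map F B)"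
    and arr_map_Id: "A \<in> Obj C \<Longrightarrow> arr_map F (Id C A) = Id D (obj_map F A)"
    and arr_map_Comp: "f \<in> hom C A B \<Longrightarrow> g \<in> hom C B K \<Longrightarrow>
      arr_map F (g \<cdot>\<^bsub>C\<^esub> f) = arr_map F g \<cdot>\<^bsub>D\<^esub> arr_map F f"

locale natural_transformation = F: functor_between C D F + G: functor_between C D G
  for C :: "('o, 'a, 'm) cat_scheme" and D :: "('p, 'b, 'n) cat_scheme"
    and F :: "('o, 'a, 'p, 'b) fmap" and G :: "('o, 'a, 'p, 'b) fmap" +
  fixes \<tau> :: "'o \<Rightarrow> 'b"
  assumes component_in_hom: "A \<in> Obj C \<Longrightarrow> \<tau> A \<in> hom D (obj_map F A) (obj_map G A)"
    and naturality: "f \<in> hom C A B \<Longrightarrow> \<tau> B \<cdot>\<^bsub>D\<^esub> arr_map F f = arr_map G f \<cdot>\<^bsub>D\<^esub> \<tau> A"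

locale monad = category C
  for C :: "('o, 'a, 'm) cat_scheme" (structure) +
  fixes R :: "('o, 'a, 'o, 'a) fmap" and \<eta> :: "'o \<Rightarrow> 'a" and \<mu> :: "'o \<Rightarrow> 'a"
  assumes endofunctor: "functor_between C C R"
    and unit_natural: "natural_transformation C C id_fmap R \<eta>"
    and mult_natural: "natural_transformation C C (comp_fmap R R) R \<mu>"
    and unit_left: "A \<in> Obj C \<Longrightarrow> \<mu> A \<cdot> \<eta> (obj_map R A) = Id C (obj_map R A)"
    and unit_right: "A \<in> Obj C \<Longrightarrow> \<mu> A \<cdot> arr_map R (\<eta> A) = Id C (obj_map R A)"
    and mult_assoc: "A \<in> Obj C \<Longrightarrow> \<mu> A \<cdot> arr_map R (\<mu> A) = \<mu> A \<cdot> \<mu> (obj_map R A)"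

locale comonad = category C
  for C :: "('o, 'a, 'm) cat_scheme" (structure) +
  fixes M :: "('o, 'a, 'o, 'a) fmap" and \<iota> :: "'o \<Rightarrow> 'a" and \<delta> :: "'o \<Rightarrow> 'a"
  assumes endofunctor: "functor_between C C M"
    and counit_natural: "natural_transformation C C M id_fmap \<iota>"
    and comult_natural: "natural_transformation C C M (comp_fmap M M) \<delta>"
    and counit_left: "A \<in> Obj C \<Longrightarrow> \<iota> (obj_map M A) \<cdot> \<delta> A = Id C (obj_map M A)"
    and counit_right: "A \<in> Obj C \<Longrightarrow> arr_map M (\<iota> A) \<cdot> \<delta> A = Id C (obj_map M A)"
    and comult_coassoc: "A \<in> Obj C \<Longrightarrow> arr_map M (\<delta> A) \<cdot> \<delta> A = \<delta> (obj_map M A) \<cdot> \<delta> A"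

text \<open>
  The comultiplication of an idempotent comonad is determined by the counit: its component at
  \<open>A\<close> is the inverse of \<open>arr_map M (\<iota> A)\<close>. It is therefore existentially quantified.
\<close>

definition idempotent_comonad ::
    "('o, 'a, 'm) cat_scheme \<Rightarrow> ('o, 'a, 'o, 'a) fmap \<Rightarrow> ('o \<Rightarrow> 'a) \<Rightarrow> bool" where
  "idempotent_comonad C M \<iota> \<longleftrightarrow>
     (\<exists>\<delta>. comonad C M \<iota> \<delta> \<and> (\<forall>A \<in> Obj C. iso C (\<delta> A)))"

text \<open>\<open>i\<close> is the injection from \<open>Cod C f\<close> and \<open>j\<close> the one from \<open>Cod C g\<close>.\<close>

definition is_cocone :: "('o, 'a, 'm) cat_scheme \<Rightarrow> 'a \<Rightarrow> 'a \<Rightarrow> 'a \<Rightarrow> 'a \<Rightarrow> bool" where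
  "is_cocone C f g i j \<longleftrightarrow>
     f \<in> Arr C \<and> g \<in> Arr C \<and> Dom C f = Dom C g \<and>
     i \<in> Arr C \<and> j \<in> Arr C \<and> Dom C i = Cod C f \<and> Dom C j = Cod C g \<and> Cod C i = Cod C j \<and>
     i \<cdot>\<^bsub>C\<^esub> f = j \<cdot>\<^bsub>C\<^esub> g"

definition is_pushout :: "('o, 'a, 'm) cat_scheme \<Rightarrow> 'a \<Rightarrow> 'a \<Rightarrow> 'a \<Rightarrow> 'a \<Rightarrow> bool" where
  "is_pushout C f g i j \<longleftrightarrow>
     is_cocone C f g i j \<and>
     (\<forall>u v. is_cocone C f g u v \<longrightarrow>
        (\<exists>!h. h \<in> hom C (Cod C i) (Cod C u) \<and> h \<cdot>\<^bsub>C\<^esub> i = u \<and> h \<cdot>\<^bsub>C\<^esub> j = v))"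

definition chosen_pushouts :: "('o, 'a, 'm) cat_scheme \<Rightarrow> ('a \<Rightarrow> 'a \<Rightarrow> 'a \<times> 'a) \<Rightarrow> bool" where
  "chosen_pushouts C po \<longleftrightarrow>
     (\<forall>f \<in> Arr C. \<forall>g \<in> Arr C. Dom C f = Dom C g \<longrightarrow>
        is_pushout C f g (fst (po f g)) (snd (po f g)))"

definition preserves_pushouts ::
    "('o, 'a, 'm) cat_scheme \<Rightarrow> ('p, 'b, 'n) cat_scheme \<Rightarrow> ('o, 'a, 'p, 'b) fmap \<Rightarrow> bool" where
  "preserves_pushouts C D F \<longleftrightarrow>
     (\<forall>f g i j. is_pushout C f g i j \<longrightarrow>
        is_pushout D (arr_map F f) (arr_map F g) (arr_map F i) (arr_map F j))"

locale orthogonal_factorisation_system = category C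
  for C :: "('o, 'a, 'm) cat_scheme" (structure) +
  fixes \<E> :: "'a set" and \<M> :: "'a set"
  assumes E_subset: "\<E> \<subseteq> Arr C"
    and M_subset: "\<M> \<subseteq> Arr C"
    and iso_in_E: "iso C f \<Longrightarrow> f \<in> \<E>"
    and iso_in_M: "iso C f \<Longrightarrow> f \<in> \<M>"
    and E_Comp: "f \<in> \<E> \<Longrightarrow> g \<in> \<E> \<Longrightarrow> Dom C g = Cod C f \<Longrightarrow> g \<cdot> f \<in> \<E>"
    and M_Comp: "f \<in> \<M> \<Longrightarrow> g \<in> \<M> \<Longrightarrow> Dom C g = Cod C f \<Longrightarrow> g \<cdot> f \<in> \<M>"
    and factorisation: "f \<in> Arr C \<Longrightarrow> \<exists>e \<in> \<E>. \<exists>m \<in> \<M>. Dom C m = Cod C e \<and> m \<cdot> e = f"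
    and orthogonality: "e \<in> \<E> \<Longrightarrow> m \<in> \<M> \<Longrightarrow>
      f \<in> hom C (Dom C e) (Dom C m) \<Longrightarrow> g \<in> hom C (Cod C e) (Cod C m) \<Longrightarrow> m \<cdot> f = g \<cdot> e \<Longrightarrow>
      \<exists>!h. h \<in> hom C (Cod C e) (Dom C m) \<and> h \<cdot> e = f \<and> m \<cdot> h = g"

definition chosen_factorisations ::
    "('o, 'a, 'm) cat_scheme \<Rightarrow> 'a set \<Rightarrow> 'a set \<Rightarrow> ('a \<Rightarrow> 'a \<times> 'a) \<Rightarrow> bool" where
  "chosen_factorisations C \<E> \<M> fac \<longleftrightarrow>
     (\<forall>f \<in> Arr C. fst (fac f) \<in> \<E> \<and> snd (fac f) \<in> \<M> \<and>
        Dom C (snd (fac f)) = Cod C (fst (fac f)) \<and> snd (fac f) \<cdot>\<^bsub>C\<^esub> fst (fac f) = f)"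

text \<open>
  \<open>Square f g h k\<close> is the morphism \<open>\<langle>h, k\<rangle>: f \<rightarrow> g\<close>; it records \<open>f\<close> and \<open>g\<close>
  because the pair \<open>h\<close>, \<open>k\<close> does not determine them.
\<close>

datatype 'a square = Square (sq_dom: 'a) (sq_cod: 'a) (sq_top: 'a) (sq_bot: 'a)

definition arrow_category :: "('o, 'a, 'm) cat_scheme \<Rightarrow> ('a, 'a square) cat" where
  "arrow_category C =
     \<lparr>Obj = Arr C,
      Arr = {Square f g h k | f g h k.
               f \<in> Arr C \<and> g \<in> Arr C \<and>
               h \<in> hom C (Dom C f) (Dom C g) \<and> k \<in> hom C (Cod C f) (Cod C g) \<and>
               k \<cdot>\<^bsub>C\<^esub> f = g \<cdot>\<^bsub>C\<^esub> h},
      Dom = sq_dom,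
      Cod = sq_cod,
      Id = (\<lambda>f. Square f f (Id C (Dom C f)) (Id C (Cod C f))),
      Comp = (\<lambda>\<tau> \<sigma>. Square (sq_dom \<sigma>) (sq_cod \<tau>)
                (sq_top \<tau> \<cdot>\<^bsub>C\<^esub> sq_top \<sigma>) (sq_bot \<tau> \<cdot>\<^bsub>C\<^esub> sq_bot \<sigma>))\<rparr>"

text \<open>
  The locale carries no assumptions, so its constants are total functions of the data; the
  definite descriptions denote the intended unique arrows only under the hypotheses on
  \<open>C\<close>, \<open>po\<close>, \<open>fac\<close>, \<open>M\<close> and \<open>\<iota>\<close>. The functors \<open>J\<close> and \<open>E\<close> are written \<open>J\<close>, \<open>E\<close> on objects and
  \<open>Jmap\<close>, \<open>Emap\<close> on arrows of the arrow category.
\<close>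

locale monad_construction =
  fixes C :: "('o, 'a, 'm) cat_scheme" (structure)
    and po :: "'a \<Rightarrow> 'a \<Rightarrow> 'a \<times> 'a"
    and fac :: "'a \<Rightarrow> 'a \<times> 'a"
    and M :: "('o, 'a, 'o, 'a) fmap"
    and \<iota> :: "'o \<Rightarrow> 'a"
begin

definition S :: "'a \<Rightarrow> 'a" where
  "S f = fst (fac (f \<cdot> \<iota> (Dom C f)))"

definition T :: "'a \<Rightarrow> 'a" where
  "T f = snd (fac (f \<cdot> \<iota> (Dom C f)))"

definition J :: "'a \<Rightarrow> 'o" where
  "J f = Cod C (S f)"

definition Jmap :: "'a square \<Rightarrow> 'a" where
  "Jmap \<sigma> = (THE j. j \<in> hom C (J (sq_dom \<sigma>)) (J (sq_cod \<sigma>)) \<and>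
     j \<cdot> S (sq_dom \<sigma>) = S (sq_cod \<sigma>) \<cdot> arr_map M (sq_top \<sigma>) \<and>
     T (sq_cod \<sigma>) \<cdot> j = sq_bot \<sigma> \<cdot> T (sq_dom \<sigma>))"

definition \<nu> :: "'a \<Rightarrow> 'a" where
  "\<nu> f = (THE n. n \<in> hom C (J (T f)) (J f) \<and>
     n \<cdot> S (T f) = \<iota> (J f) \<and> T f \<cdot> n = T (T f))"

definition L :: "'a \<Rightarrow> 'a" where
  "L f = fst (po (\<iota> (Dom C f)) (S f))"

definition \<alpha> :: "'a \<Rightarrow> 'a" where
  "\<alpha> f = snd (po (\<iota> (Dom C f)) (S f))"

definition E :: "'a \<Rightarrow> 'o" where
  "E f = Cod C (L f)"

definition R_obj :: "'a \<Rightarrow> 'a" where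
  "R_obj f = (THE r. r \<in> hom C (E f) (Cod C f) \<and> r \<cdot> L f = f \<and> r \<cdot> \<alpha> f = T f)"

definition Emap :: "'a square \<Rightarrow> 'a" where
  "Emap \<sigma> = (THE e. e \<in> hom C (E (sq_dom \<sigma>)) (E (sq_cod \<sigma>)) \<and>
     e \<cdot> L (sq_dom \<sigma>) = L (sq_cod \<sigma>) \<cdot> sq_top \<sigma> \<and>
     e \<cdot> \<alpha> (sq_dom \<sigma>) = \<alpha> (sq_cod \<sigma>) \<cdot> Jmap \<sigma>)"

definition R :: "('a, 'a square, 'a, 'a square) fmap" where
  "R = \<lparr>obj_map = R_obj,
        arr_map = (\<lambda>\<sigma>. Square (R_obj (sq_dom \<sigma>)) (R_obj (sq_cod \<sigma>)) (Emap \<sigma>) (sq_bot \<sigma>))\<rparr>"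

definition \<eta> :: "'a \<Rightarrow> 'a square" where
  "\<eta> f = Square f (R_obj f) (L f) (Id C (Cod C f))"

definition \<mu>_top :: "'a \<Rightarrow> 'a" where
  "\<mu>_top f = (THE m. m \<in> hom C (E (R_obj f)) (E f) \<and>
     m \<cdot> L (R_obj f) = Id C (E f) \<and>
     m \<cdot> \<alpha> (R_obj f) =
       \<alpha> f \<cdot> \<nu> f \<cdot> inv_arrow C (Jmap (Square (T f) (R_obj f) (\<alpha> f) (Id C (Cod C f)))))"

definition \<mu> :: "'a \<Rightarrow> 'a square" where
  "\<mu> f = Square (R_obj (R_obj f)) (R_obj f) (\<mu>_top f) (Id C (Cod C f))"

end

end

theory Submission
  imports Defs
begin

text \<open>
  Since \<open>M\<close> preserves pushouts and inverts \<open>\<iota>\<close>, it inverts \<open>\<alpha> f\<close>, a pushout of \<open>\<iota>\<close>. The composite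
  \<open>\<gamma> f: J (R f) \<rightarrow> J f\<close> of \<open>\<nu> f\<close> with \<open>J\<langle>\<alpha> f, 1\<rangle>\<inverse>\<close> is therefore characterised by
  \<open>\<gamma> f \<cdot> S (R f) \<cdot> M (\<alpha> f) = \<iota> (J f)\<close> and \<open>T f \<cdot> \<gamma> f = T (R f)\<close>. Arrows out of \<open>E f\<close> are compared on
  \<open>L f\<close> and \<open>\<alpha> f\<close>, which reduces naturality of \<open>\<mu>\<close>, the right unit law and associativity to the equations
  \<open>\<gamma> g \<cdot> J (R \<sigma>) = J \<sigma> \<cdot> \<gamma> f\<close>, \<open>\<gamma> f \<cdot> J (\<eta> f) = 1\<close> and \<open>\<gamma> f \<cdot> J (\<mu> f) = \<gamma> f \<cdot> \<gamma> (R f)\<close>. Each of these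
  follows from the characterisation by orthogonality; the second one also needs \<open>M (\<iota> A) = \<iota> (M A)\<close>.
\<close>

section \<open>Arrow calculus, isomorphisms and pushouts in a category\<close>

lemma hom_iff: "f \<in> hom C A B \<longleftrightarrow> f \<in> Arr C \<and> Dom C f = A \<and> Cod C f = B"
  by (auto simp: hom_def)

context category
begin

declare Dom_in_Obj [simp] Cod_in_Obj [simp]

lemma Id_simps [simp]:
  assumes "A \<in> Obj C"
  shows "Id C A \<in> Arr C" "Dom C (Id C A) = A" "Cod C (Id C A) = A"
  using Id_in_hom[OF assms] by (auto simp: hom_iff)

lemma Comp_simps [simp]:
  assumes "f \<in> Arr C" "g \<in> Arr C" "Dom C g = Cod C f"
  shows "g \<cdot> f \<in> Arr C" "Dom C (g \<cdot> f) = Dom C f" "Cod C (g \<cdot> f) = Cod C g"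
  using Comp_in_hom[of f "Dom C f" "Cod C f" g "Cod C g"] assms by (auto simp: hom_iff)

lemma Comp_Id_right [simp]: "f \<in> Arr C \<Longrightarrow> Dom C f = A \<Longrightarrow> f \<cdot> Id C A = f"
  using Comp_Id by (auto simp: hom_iff)

lemma Comp_Id_left [simp]: "f \<in> Arr C \<Longrightarrow> Cod C f = A \<Longrightarrow> Id C A \<cdot> f = f"
  using Id_Comp by (auto simp: hom_iff)

lemma Comp_assoc_right [simp]:
  "f \<in> Arr C \<Longrightarrow> g \<in> Arr C \<Longrightarrow> h \<in> Arr C \<Longrightarrow> Dom C g = Cod C f \<Longrightarrow> Dom C h = Cod C g \<Longrightarrow>
    (h \<cdot> g) \<cdot> f = h \<cdot> (g \<cdot> f)"
  using Comp_assoc[of f "Dom C f" "Cod C f" g "Cod C g" h "Cod C h"] by (auto simp: hom_iff)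

text \<open>Simplification nests composites to the right, which hides a product
  \<open>x \<cdot> y\<close> inside \<open>x \<cdot> (y \<cdot> w)\<close>. This form lets an
  equation for \<open>x \<cdot> y\<close> rewrite there too; it is used throughout as
  \<open>rules[THEN Comp_reduce]\<close>.\<close>

lemma Comp_reduce:
  assumes "x \<cdot> y = z" "x \<in> Arr C" "y \<in> Arr C" "w \<in> Arr C" "Dom C x = Cod C y" "Dom C y = Cod C w"
  shows "x \<cdot> (y \<cdot> w) = z \<cdot> w"
  using assms(2-) by (simp add: assms(1)[symmetric])

lemma inverse_arrowsI:
  assumes "f \<in> Arr C" "g \<in> Arr C" "Dom C g = Cod C f" "Cod C g = Dom C f"
    "g \<cdot> f = Id C (Dom C f)" "f \<cdot> g = Id C (Cod C f)"
  shows "inverse_arrows C f g"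
  using assms by (simp add: inverse_arrows_def hom_iff)

lemma inverse_arrows_unique:
  assumes "inverse_arrows C f g" "inverse_arrows C f h"
  shows "g = h"
proof -
  have "g = g \<cdot> (f \<cdot> h)" using assms by (simp add: inverse_arrows_def hom_iff)
  also have "\<dots> = (g \<cdot> f) \<cdot> h"
    using assms by (subst Comp_assoc_right) (simp_all add: inverse_arrows_def hom_iff)
  also have "\<dots> = h" using assms by (simp add: inverse_arrows_def hom_iff)
  finally show ?thesis .
qed

lemma inverse_arrows_inv_arrow: "iso C f \<Longrightarrow> inverse_arrows C f (inv_arrow C f)"
  unfolding iso_def inv_arrow_def by (blast intro: theI inverse_arrows_unique)

lemma inv_arrow_simps [simp]:
  assumes "iso C f"
  shows "inv_arrow C f \<in> Arr C" "Dom C (inv_arrow C f) = Cod C f"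
    "Cod C (inv_arrow C f) = Dom C f"
    "inv_arrow C f \<cdot> f = Id C (Dom C f)" "f \<cdot> inv_arrow C f = Id C (Cod C f)"
  using inverse_arrows_inv_arrow[OF assms] by (auto simp: inverse_arrows_def hom_iff)

lemma iso_Arr: "iso C f \<Longrightarrow> f \<in> Arr C"
  by (auto simp: iso_def inverse_arrows_def)

lemma iso_cancel_right:
  assumes "iso C e" "x \<in> Arr C" "y \<in> Arr C" "Dom C x = Cod C e" "Dom C y = Cod C e"
    "x \<cdot> e = y \<cdot> e"
  shows "x = y"
proof -
  note e = iso_Arr[OF assms(1)]
  have "(x \<cdot> e) \<cdot> inv_arrow C e = (y \<cdot> e) \<cdot> inv_arrow C e" using assms by simp
  then show ?thesis using assms(1-5) e by simp
qed

text \<open>The cocone consisting of \<open>g \<cdot> inv_arrow C f\<close> and the identity induces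
  an arrow \<open>h\<close> with \<open>h \<cdot> j\<close> the identity. Since
  \<open>j \<cdot> h\<close> fixes both injections, uniqueness for the cocone \<open>i\<close>,
  \<open>j\<close> makes it the identity as well.\<close>

lemma pushout_iso:
  assumes po: "is_pushout C f g i j" and f: "iso C f"
  shows "iso C j"
proof -
  have c: "is_cocone C f g i j" using po by (simp add: is_pushout_def)
  have [simp]: "f \<in> Arr C" "g \<in> Arr C" "i \<in> Arr C" "j \<in> Arr C" "Dom C g = Dom C f"
    "Dom C i = Cod C f" "Dom C j = Cod C g" "Cod C i = Cod C j"
    and comm: "i \<cdot> f = j \<cdot> g"
    using c by (auto simp: is_cocone_def)
  have "is_cocone C f g (g \<cdot> inv_arrow C f) (Id C (Cod C g))"
    using f by (simp add: is_cocone_def)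
  then have "\<exists>!h. h \<in> hom C (Cod C i) (Cod C (g \<cdot> inv_arrow C f)) \<and>
      h \<cdot> i = g \<cdot> inv_arrow C f \<and> h \<cdot> j = Id C (Cod C g)"
    using po unfolding is_pushout_def by blast
  then obtain h where [simp]: "h \<in> Arr C" "Dom C h = Cod C j" "Cod C h = Cod C g"
    and h: "h \<cdot> i = g \<cdot> inv_arrow C f" "h \<cdot> j = Id C (Cod C g)"
    using f by (auto simp: hom_iff)
  have "j \<cdot> (g \<cdot> inv_arrow C f) = i"
    using f comm[symmetric] Comp_reduce[OF comm[symmetric], of "inv_arrow C f"] by simp
  then have 1: "(j \<cdot> h) \<cdot> i = i" "(j \<cdot> h) \<cdot> j = j"
    using h by simp_all
  have "\<exists>!x. x \<in> hom C (Cod C i) (Cod C i) \<and> x \<cdot> i = i \<and> x \<cdot> j = j"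
    using po c unfolding is_pushout_def by blast
  moreover have "j \<cdot> h \<in> hom C (Cod C i) (Cod C i)" "Id C (Cod C j) \<in> hom C (Cod C i) (Cod C i)"
    by (simp_all add: hom_iff)
  moreover have "Id C (Cod C j) \<cdot> i = i" "Id C (Cod C j) \<cdot> j = j" by simp_all
  ultimately have "j \<cdot> h = Id C (Cod C j)" using 1 by blast
  then have "inverse_arrows C j h" using h by (intro inverse_arrowsI) simp_all
  then show ?thesis by (auto simp: iso_def)
qed

end

section \<open>The arrow category\<close>

lemma arrow_category_simps [simp]:
  "Obj (arrow_category C) = Arr C"
  "Dom (arrow_category C) = sq_dom"
  "Cod (arrow_category C) = sq_cod"
  "Id (arrow_category C) f = Square f f (Id C (Dom C f)) (Id C (Cod C f))"
  "Comp (arrow_category C) \<tau> \<sigma> = Square (sq_dom \<sigma>) (sq_cod \<tau>)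
     (sq_top \<tau> \<cdot>\<^bsub>C\<^esub> sq_top \<sigma>) (sq_bot \<tau> \<cdot>\<^bsub>C\<^esub> sq_bot \<sigma>)"
  by (simp_all add: arrow_category_def)

lemma Square_in_Arr_iff:
  "Square f g h k \<in> Arr (arrow_category C) \<longleftrightarrow>
     f \<in> Arr C \<and> g \<in> Arr C \<and> h \<in> Arr C \<and> k \<in> Arr C \<and>
     Dom C h = Dom C f \<and> Cod C h = Dom C g \<and> Dom C k = Cod C f \<and> Cod C k = Cod C g \<and>
     k \<cdot>\<^bsub>C\<^esub> f = g \<cdot>\<^bsub>C\<^esub> h"
  by (auto simp: arrow_category_def hom_iff)

lemma (in category) category_arrow_category: "category (arrow_category C)"
proof (unfold_locales, goal_cases)
  case (1 \<sigma>) then show ?case by (cases \<sigma>) (simp add: Square_in_Arr_iff)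
next
  case (2 \<sigma>) then show ?case by (cases \<sigma>) (simp add: Square_in_Arr_iff)
next
  case (3 f) then show ?case by (simp add: hom_iff Square_in_Arr_iff)
next
  case (4 \<sigma> f g \<tau> k)
  then obtain h1 k1 h2 k2 where [simp]: "\<sigma> = Square f g h1 k1" "\<tau> = Square g k h2 k2"
    by (cases \<sigma>; cases \<tau>) (auto simp: hom_iff)
  have sq: "k1 \<cdot> f = g \<cdot> h1" "k2 \<cdot> g = k \<cdot> h2"
    using 4 by (simp_all add: hom_iff Square_in_Arr_iff)
  show ?case
    using 4 by (simp add: hom_iff Square_in_Arr_iff sq Comp_reduce[OF sq(2)])
next
  case (5 \<sigma>) then show ?case by (cases \<sigma>) (auto simp: hom_iff Square_in_Arr_iff)
next
  case (6 \<sigma>) then show ?case by (cases \<sigma>) (auto simp: hom_iff Square_in_Arr_iff)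
next
  case (7 \<sigma> f g \<tau> k \<rho> l)
  then show ?case
    by (cases \<sigma>; cases \<tau>; cases \<rho>) (auto simp: hom_iff Square_in_Arr_iff)
qed

section \<open>The standing hypotheses and the idempotent comonad\<close>

locale comonad_factorisation =
  monad_construction C po fac M \<iota> + orthogonal_factorisation_system C \<E> \<M>
  for C :: "('o, 'a, 'm) cat_scheme" (structure)
    and po fac M \<iota> \<E> \<M> +
  assumes pushouts: "chosen_pushouts C po"
    and factorisations: "chosen_factorisations C \<E> \<M> fac"
    and idempotent: "idempotent_comonad C M \<iota>"
    and M_pushouts: "preserves_pushouts C C M"
begin

abbreviation "AC \<equiv> arrow_category C"

lemma M_functor: "functor_between C C M" and iota_natural: "natural_transformation C C M id_fmap \<iota>"
  using idempotent by (auto simp: idempotent_comonad_def comonad_def comonad_axioms_def)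

lemma M_obj [simp]: "A \<in> Obj C \<Longrightarrow> obj_map M A \<in> Obj C"
  using M_functor by (rule functor_between.obj_map_in_Obj)

lemma M_arr [simp]:
  assumes "f \<in> Arr C"
  shows "arr_map M f \<in> Arr C" "Dom C (arr_map M f) = obj_map M (Dom C f)"
    "Cod C (arr_map M f) = obj_map M (Cod C f)"
  using functor_between.arr_map_in_hom[OF M_functor, of f "Dom C f" "Cod C f"] assms
  by (auto simp: hom_iff)

lemma M_Id [simp]: "A \<in> Obj C \<Longrightarrow> arr_map M (Id C A) = Id C (obj_map M A)"
  using M_functor by (rule functor_between.arr_map_Id)

lemma M_Comp:
  "f \<in> Arr C \<Longrightarrow> g \<in> Arr C \<Longrightarrow> Dom C g = Cod C f \<Longrightarrow>
    arr_map M (g \<cdot> f) = arr_map M g \<cdot> arr_map M f"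
  using functor_between.arr_map_Comp[OF M_functor, of f "Dom C f" "Cod C f" g "Cod C g"]
  by (auto simp: hom_iff)

lemma iota_arr [simp]:
  assumes "A \<in> Obj C"
  shows "\<iota> A \<in> Arr C" "Dom C (\<iota> A) = obj_map M A" "Cod C (\<iota> A) = A"
  using natural_transformation.component_in_hom[OF iota_natural assms]
  by (auto simp: hom_iff id_fmap_def)

lemma iota_M:
  "f \<in> Arr C \<Longrightarrow> Cod C f = B \<Longrightarrow> \<iota> B \<cdot> arr_map M f = f \<cdot> \<iota> (Dom C f)"
  using natural_transformation.naturality[OF iota_natural, of f "Dom C f" B]
  by (auto simp: hom_iff id_fmap_def)

text \<open>By the two counit laws, \<open>arr_map M (\<iota> A)\<close> and
  \<open>\<iota> (obj_map M A)\<close> are both left inverses of \<open>\<delta> A\<close>. As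
  \<open>\<delta> A\<close> is invertible, both equal its inverse.\<close>

lemma iso_M_iota: "A \<in> Obj C \<Longrightarrow> iso C (arr_map M (\<iota> A))"
  and M_iota: "A \<in> Obj C \<Longrightarrow> arr_map M (\<iota> A) = \<iota> (obj_map M A)"
proof -
  assume A [simp]: "A \<in> Obj C"
  obtain \<delta> where "comonad C M \<iota> \<delta>" and iso: "iso C (\<delta> A)"
    using idempotent A by (auto simp: idempotent_comonad_def)
  then interpret comonad C M \<iota> \<delta> by simp
  have [simp]: "\<delta> A \<in> Arr C" "Dom C (\<delta> A) = obj_map M A" "Cod C (\<delta> A) = obj_map M (obj_map M A)"
    using natural_transformation.component_in_hom[OF comult_natural A]
    by (auto simp: hom_iff comp_fmap_def)
  have *: "arr_map M (\<iota> A) \<cdot> \<delta> A = Id C (obj_map M A)" "\<iota> (obj_map M A) \<cdot> \<delta> A = Id C (obj_map M A)"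
    by (simp_all add: counit_left counit_right)
  show eq: "arr_map M (\<iota> A) = \<iota> (obj_map M A)"
    by (rule iso_cancel_right[OF iso]) (simp_all add: *)
  have "arr_map M (\<iota> A) = inv_arrow C (\<delta> A)"
    by (rule iso_cancel_right[OF iso]) (simp_all add: * iso)
  then have "inverse_arrows C (arr_map M (\<iota> A)) (\<delta> A)"
    by (intro inverse_arrowsI) (simp_all add: iso)
  then show "iso C (arr_map M (\<iota> A))" by (auto simp: iso_def)
qed

section \<open>The factorisation into \<open>S\<close> and \<open>T\<close>, and the action of
  \<open>J\<close>\<close>

lemma S_T_props:
  assumes "f \<in> Arr C"
  shows "S f \<in> \<E>" "T f \<in> \<M>" "Dom C (S f) = obj_map M (Dom C f)" "Dom C (T f) = J f"
    "Cod C (T f) = Cod C f" "T f \<cdot> S f = f \<cdot> \<iota> (Dom C f)"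
proof -
  let ?p = "fac (f \<cdot> \<iota> (Dom C f))"
  have *: "fst ?p \<in> \<E> \<and> snd ?p \<in> \<M> \<and> Dom C (snd ?p) = Cod C (fst ?p) \<and>
      snd ?p \<cdot> fst ?p = f \<cdot> \<iota> (Dom C f)"
    using factorisations assms by (simp add: chosen_factorisations_def)
  then have "fst ?p \<in> Arr C" "snd ?p \<in> Arr C" using E_subset M_subset by auto
  \<comment> \<open>The choice only records that the factors are composable with the given
    composite, so the outer domain and codomain are read off from that composite.\<close>
  then have "Dom C (fst ?p) = Dom C (snd ?p \<cdot> fst ?p)" "Cod C (snd ?p) = Cod C (snd ?p \<cdot> fst ?p)"
    using * Comp_simps(2,3)[of "fst ?p" "snd ?p"] by metis+
  then show "S f \<in> \<E>" "T f \<in> \<M>" "Dom C (S f) = obj_map M (Dom C f)" "Dom C (T f) = J f"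
    "Cod C (T f) = Cod C f" "T f \<cdot> S f = f \<cdot> \<iota> (Dom C f)"
    using * assms by (simp_all add: S_def T_def J_def)
qed

lemma S_T_arr [simp]:
  assumes "f \<in> Arr C"
  shows "S f \<in> Arr C" "Dom C (S f) = obj_map M (Dom C f)" "Cod C (S f) = J f"
    "T f \<in> Arr C" "Dom C (T f) = J f" "Cod C (T f) = Cod C f" "J f \<in> Obj C"
proof -
  show *: "S f \<in> Arr C" "T f \<in> Arr C"
    using S_T_props[OF assms] E_subset M_subset by auto
  show "Dom C (S f) = obj_map M (Dom C f)" "Cod C (S f) = J f" "Dom C (T f) = J f" "Cod C (T f) = Cod C f" "J f \<in> Obj C"
    using S_T_props[OF assms] * by (auto simp: J_def)
qed

lemmas T_S = S_T_props(6)

text \<open>Uniqueness of diagonal fillers: \<open>x\<close> and \<open>y\<close> fill the same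
  square between \<open>S f\<close> in \<open>\<E>\<close> and \<open>T g\<close> in
  \<open>\<M>\<close>.\<close>

lemma J_eqI:
  assumes "f \<in> Arr C" "g \<in> Arr C" "x \<in> Arr C" "y \<in> Arr C"
    "Dom C x = J f" "Dom C y = J f" "Cod C x = J g" "Cod C y = J g"
    "x \<cdot> S f = y \<cdot> S f" "T g \<cdot> x = T g \<cdot> y"
  shows "x = y"
proof -
  have "\<exists>!h. h \<in> hom C (Cod C (S f)) (Dom C (T g)) \<and> h \<cdot> S f = x \<cdot> S f \<and> T g \<cdot> h = T g \<cdot> x"
    using assms by (intro orthogonality) (simp_all add: S_T_props hom_iff)
  then show ?thesis using assms by (auto simp: hom_iff)
qed

text \<open>The existence half of orthogonality, phrased for definite descriptions:
  \<open>Jmap\<close>, \<open>\<nu>\<close> and the inverse in \<open>iso_Jmap\<close> are all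
  fillers of this shape.\<close>

lemma J_the:
  assumes "f \<in> Arr C" "g \<in> Arr C" "u \<in> Arr C" "v \<in> Arr C"
    "Dom C u = obj_map M (Dom C f)" "Cod C u = J g" "Dom C v = J f" "Cod C v = Cod C g"
    "T g \<cdot> u = v \<cdot> S f"
  defines "j \<equiv> THE j. j \<in> hom C (J f) (J g) \<and> j \<cdot> S f = u \<and> T g \<cdot> j = v"
  shows "j \<in> Arr C \<and> Dom C j = J f \<and> Cod C j = J g \<and> j \<cdot> S f = u \<and> T g \<cdot> j = v"
proof -
  have "\<exists>!j. j \<in> hom C (Cod C (S f)) (Dom C (T g)) \<and> j \<cdot> S f = u \<and> T g \<cdot> j = v"
    using assms by (intro orthogonality) (simp_all add: S_T_props hom_iff)
  then have "\<exists>!j. j \<in> hom C (J f) (J g) \<and> j \<cdot> S f = u \<and> T g \<cdot> j = v"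
    using assms by simp
  from theI'[OF this] show ?thesis by (simp add: j_def hom_iff)
qed

lemma Jmap_props:
  assumes "Square f g h k \<in> Arr AC"
  defines "j \<equiv> Jmap (Square f g h k)"
  shows "j \<in> Arr C" "Dom C j = J f" "Cod C j = J g"
    "j \<cdot> S f = S g \<cdot> arr_map M h" "T g \<cdot> j = k \<cdot> T f"
proof -
  have a [simp]: "f \<in> Arr C" "g \<in> Arr C" "h \<in> Arr C" "k \<in> Arr C"
     "Dom C h = Dom C f" "Cod C h = Dom C g" "Dom C k = Cod C f" "Cod C k = Cod C g"
     and c: "k \<cdot> f = g \<cdot> h"
    using assms by (simp_all add: Square_in_Arr_iff)
  have "T g \<cdot> (S g \<cdot> arr_map M h) = (k \<cdot> T f) \<cdot> S f"
    by (simp add: T_S Comp_reduce[OF T_S] iota_M Comp_reduce[OF c[symmetric]])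
  note * = J_the[OF a(1,2) _ _ _ _ _ _ this]
  show "j \<in> Arr C" "Dom C j = J f" "Cod C j = J g"
    "j \<cdot> S f = S g \<cdot> arr_map M h" "T g \<cdot> j = k \<cdot> T f"
    using * by (simp_all add: j_def Jmap_def)
qed

lemmas Jmap_arr [simp] = Jmap_props(1-3)
lemmas Jmap_S = Jmap_props(4)
lemmas T_Jmap = Jmap_props(5)

text \<open>When the bottom arrow is an identity and \<open>arr_map M h\<close> is invertible, the
  square can be filled in the opposite direction, with \<open>S f \<cdot> ?w\<close> on top.
  Uniqueness of fillers makes the two arrows mutually inverse.\<close>

lemma iso_Jmap:
  assumes sq: "Square f g h (Id C (Cod C f)) \<in> Arr AC" and iso: "iso C (arr_map M h)"
  shows "iso C (Jmap (Square f g h (Id C (Cod C f))))"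
proof -
  let ?j = "Jmap (Square f g h (Id C (Cod C f)))" and ?w = "inv_arrow C (arr_map M h)"
  have a [simp]: "f \<in> Arr C" "g \<in> Arr C" "h \<in> Arr C"
     "Dom C h = Dom C f" "Cod C h = Dom C g" "Cod C g = Cod C f" and c: "g \<cdot> h = f"
    using sq by (auto simp: Square_in_Arr_iff)
  note [simp] = iso
  \<comment> \<open>Composing with \<open>arr_map M h\<close> cancels \<open>?w\<close>; both sides
    then equal \<open>f \<cdot> \<iota> (Dom C f)\<close>.\<close>
  have "T f \<cdot> (S f \<cdot> ?w) = T g \<cdot> S g"
    by (rule iso_cancel_right[OF iso])
      (simp_all add: T_S Comp_reduce[OF T_S] iota_M Comp_reduce[OF c] Comp_reduce[OF T_Jmap])
  note j' = J_the[OF a(2,1) _ _ _ _ _ _ this]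
  obtain j' where [simp]: "j' \<in> Arr C" "Dom C j' = J g" "Cod C j' = J f"
    and j'_S: "j' \<cdot> S g = S f \<cdot> ?w" and T_j': "T f \<cdot> j' = T g"
    using j' by auto
  note [simp] = Jmap_arr[OF sq]
  note rules = Jmap_S[OF sq] T_Jmap[OF sq] j'_S T_j'
  note rules = rules rules[THEN Comp_reduce]
  have "j' \<cdot> ?j = Id C (J f)"
    by (rule J_eqI[of f f]) (simp_all add: rules)
  moreover have "?j \<cdot> j' = Id C (J g)"
    by (rule J_eqI[of g g]) (simp_all add: rules)
  ultimately have "inverse_arrows C ?j j'" by (intro inverse_arrowsI) simp_all
  then show ?thesis by (auto simp: iso_def)
qed

section \<open>The pushout \<open>E\<close>, the arrow \<open>R_obj\<close> and the action of
  \<open>E\<close>\<close>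

lemma pushout_E: "f \<in> Arr C \<Longrightarrow> is_pushout C (\<iota> (Dom C f)) (S f) (L f) (\<alpha> f)"
  using pushouts by (simp add: chosen_pushouts_def L_def \<alpha>_def)

lemma L_\<alpha>_arr [simp]:
  assumes "f \<in> Arr C"
  shows "L f \<in> Arr C" "Dom C (L f) = Dom C f" "Cod C (L f) = E f"
    "\<alpha> f \<in> Arr C" "Dom C (\<alpha> f) = J f" "Cod C (\<alpha> f) = E f" "E f \<in> Obj C"
  using pushout_E[OF assms] assms Cod_in_Obj[of "L f"]
  by (auto simp: is_pushout_def is_cocone_def E_def)

lemma L_\<iota>: "f \<in> Arr C \<Longrightarrow> L f \<cdot> \<iota> (Dom C f) = \<alpha> f \<cdot> S f"
  using pushout_E[of f] by (auto simp: is_pushout_def is_cocone_def)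

lemma E_ex1:
  assumes "f \<in> Arr C" "u \<in> Arr C" "v \<in> Arr C" "Dom C u = Dom C f" "Dom C v = J f" "Cod C u = B"
    "Cod C v = B" "u \<cdot> \<iota> (Dom C f) = v \<cdot> S f"
  shows "\<exists>!h. h \<in> hom C (E f) B \<and> h \<cdot> L f = u \<and> h \<cdot> \<alpha> f = v"
proof -
  have "is_cocone C (\<iota> (Dom C f)) (S f) u v" using assms by (simp add: is_cocone_def)
  then show ?thesis using pushout_E[OF assms(1)] assms(1,6) unfolding is_pushout_def by (metis L_\<alpha>_arr(3))
qed

text \<open>The two pushout injections are jointly epic.\<close>

lemma E_eqI:
  assumes "f \<in> Arr C" "x \<in> Arr C" "y \<in> Arr C" "Dom C x = E f" "Dom C y = E f" "Cod C x = Cod C y"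
    "x \<cdot> L f = y \<cdot> L f" "x \<cdot> \<alpha> f = y \<cdot> \<alpha> f"
  shows "x = y"
proof -
  have "\<exists>!h. h \<in> hom C (E f) (Cod C x) \<and> h \<cdot> L f = x \<cdot> L f \<and> h \<cdot> \<alpha> f = x \<cdot> \<alpha> f"
    using assms by (intro E_ex1) (simp_all add: L_\<iota>)
  then show ?thesis using assms by (auto simp: hom_iff)
qed

lemma E_the:
  assumes "f \<in> Arr C" "u \<in> Arr C" "v \<in> Arr C" "Dom C u = Dom C f" "Dom C v = J f" "Cod C u = B"
    "Cod C v = B" "u \<cdot> \<iota> (Dom C f) = v \<cdot> S f"
  defines "h \<equiv> THE h. h \<in> hom C (E f) B \<and> h \<cdot> L f = u \<and> h \<cdot> \<alpha> f = v"
  shows "h \<in> Arr C \<and> Dom C h = E f \<and> Cod C h = B \<and> h \<cdot> L f = u \<and> h \<cdot> \<alpha> f = v"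
  using theI'[OF E_ex1[OF assms(1-8)]] by (simp add: h_def hom_iff)

lemma R_obj_props:
  assumes "f \<in> Arr C"
  shows "R_obj f \<in> Arr C" "Dom C (R_obj f) = E f" "Cod C (R_obj f) = Cod C f"
    "R_obj f \<cdot> L f = f" "R_obj f \<cdot> \<alpha> f = T f"
  using E_the[of f f "T f" "Cod C f"] assms by (simp_all add: R_obj_def T_S)

lemmas R_obj_arr [simp] = R_obj_props(1-3)
lemmas R_L = R_obj_props(4)
lemmas R_\<alpha> = R_obj_props(5)

lemma iso_M_\<alpha>:
  assumes "f \<in> Arr C"
  shows "iso C (arr_map M (\<alpha> f))"
proof (rule pushout_iso)
  show "is_pushout C (arr_map M (\<iota> (Dom C f))) (arr_map M (S f)) (arr_map M (L f)) (arr_map M (\<alpha> f))"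
    using M_pushouts pushout_E[OF assms] by (simp add: preserves_pushouts_def)
  show "iso C (arr_map M (\<iota> (Dom C f)))" using assms by (simp add: iso_M_iota)
qed

lemma Emap_props:
  assumes sq: "Square f g h k \<in> Arr AC"
  defines "e \<equiv> Emap (Square f g h k)"
  shows "e \<in> Arr C" "Dom C e = E f" "Cod C e = E g"
    "e \<cdot> L f = L g \<cdot> h" "e \<cdot> \<alpha> f = \<alpha> g \<cdot> Jmap (Square f g h k)" "R_obj g \<cdot> e = k \<cdot> R_obj f"
proof -
  have a [simp]: "f \<in> Arr C" "g \<in> Arr C" "h \<in> Arr C" "k \<in> Arr C"
     "Dom C h = Dom C f" "Cod C h = Dom C g" "Dom C k = Cod C f" "Cod C k = Cod C g"
     and c: "k \<cdot> f = g \<cdot> h"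
    using sq by (simp_all add: Square_in_Arr_iff)
  note [simp] = Jmap_arr[OF sq]
  \<comment> \<open>Cocone condition for \<open>Emap\<close>: naturality of \<open>\<iota>\<close>
    moves \<open>h\<close> across, the pushout square of \<open>g\<close> replaces
    \<open>L g\<close> by \<open>\<alpha> g\<close>, and \<open>Jmap_S\<close> finishes.\<close>
  have "(L g \<cdot> h) \<cdot> \<iota> (Dom C f) = L g \<cdot> (\<iota> (Dom C g) \<cdot> arr_map M h)"
    by (simp add: iota_M)
  also have "\<dots> = (\<alpha> g \<cdot> Jmap (Square f g h k)) \<cdot> S f"
    by (simp add: Comp_reduce[OF L_\<iota>] Jmap_S[OF sq])
  finally have "(L g \<cdot> h) \<cdot> \<iota> (Dom C f) = (\<alpha> g \<cdot> Jmap (Square f g h k)) \<cdot> S f" .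
  note * = E_the[OF a(1) _ _ _ _ _ _ this, of "E g"]
  show e [simp]: "e \<in> Arr C" "Dom C e = E f" "Cod C e = E g"
    and e_L: "e \<cdot> L f = L g \<cdot> h" and e_\<alpha>: "e \<cdot> \<alpha> f = \<alpha> g \<cdot> Jmap (Square f g h k)"
    using * by (simp_all add: e_def Emap_def)
  show "R_obj g \<cdot> e = k \<cdot> R_obj f"
    by (rule E_eqI[of f])
      (simp_all add: e_L e_\<alpha> R_L R_\<alpha> Comp_reduce[OF R_L] Comp_reduce[OF R_\<alpha>] T_Jmap[OF sq] c)
qed

lemmas Emap_arr [simp] = Emap_props(1-3)
lemmas Emap_L = Emap_props(4)
lemmas Emap_\<alpha> = Emap_props(5)

section \<open>The arrows \<open>\<nu>\<close>, \<open>\<beta>\<close>, \<open>\<gamma>\<close> and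
  \<open>\<mu>_top\<close>\<close>

lemma \<nu>_props:
  assumes "f \<in> Arr C"
  shows "\<nu> f \<in> Arr C" "Dom C (\<nu> f) = J (T f)" "Cod C (\<nu> f) = J f"
    "\<nu> f \<cdot> S (T f) = \<iota> (J f)" "T f \<cdot> \<nu> f = T (T f)"
  \<comment> \<open>The square to fill commutes because it is the chosen factorisation of
    \<open>T f \<cdot> \<iota> (J f)\<close>, that is, \<open>T_S\<close> at
    \<open>T f\<close>.\<close>
  using J_the[of "T f" f "\<iota> (J f)" "T (T f)"] assms by (simp_all add: \<nu>_def T_S)

lemmas \<nu>_arr [simp] = \<nu>_props(1-3)

abbreviation \<beta> where
  "\<beta> f \<equiv> Jmap (Square (T f) (R_obj f) (\<alpha> f) (Id C (Cod C f)))"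

definition \<gamma> where
  "\<gamma> f = \<nu> f \<cdot> inv_arrow C (\<beta> f)"

lemma \<beta>_square: "f \<in> Arr C \<Longrightarrow> Square (T f) (R_obj f) (\<alpha> f) (Id C (Cod C f)) \<in> Arr AC"
  by (simp add: Square_in_Arr_iff R_\<alpha>)

lemma \<beta>_props:
  assumes "f \<in> Arr C"
  shows "iso C (\<beta> f)" "\<beta> f \<in> Arr C" "Dom C (\<beta> f) = J (T f)" "Cod C (\<beta> f) = J (R_obj f)"
    "\<beta> f \<cdot> S (T f) = S (R_obj f) \<cdot> arr_map M (\<alpha> f)" "T (R_obj f) \<cdot> \<beta> f = T (T f)"
proof -
  note sq = \<beta>_square[OF assms]
  show "iso C (\<beta> f)"
    using iso_Jmap[of "T f" "R_obj f" "\<alpha> f"] sq iso_M_\<alpha>[OF assms] assms by simp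
  show "\<beta> f \<in> Arr C" "Dom C (\<beta> f) = J (T f)" "Cod C (\<beta> f) = J (R_obj f)"
    "\<beta> f \<cdot> S (T f) = S (R_obj f) \<cdot> arr_map M (\<alpha> f)"
    by (rule Jmap_props[OF sq])+
  show "T (R_obj f) \<cdot> \<beta> f = T (T f)"
    using T_Jmap[OF sq] assms by simp
qed

lemma \<gamma>_props:
  assumes f [simp]: "f \<in> Arr C"
  shows "\<gamma> f \<in> Arr C" "Dom C (\<gamma> f) = J (R_obj f)" "Cod C (\<gamma> f) = J f"
    "\<gamma> f \<cdot> (S (R_obj f) \<cdot> arr_map M (\<alpha> f)) = \<iota> (J f)" "T f \<cdot> \<gamma> f = T (R_obj f)"
proof -
  note [simp] = \<beta>_props(1-4)[OF f]
  show "\<gamma> f \<in> Arr C" "Dom C (\<gamma> f) = J (R_obj f)" "Cod C (\<gamma> f) = J f"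
    by (simp_all add: \<gamma>_def)
  \<comment> \<open>After composition with the invertible \<open>\<beta> f\<close>, both sides
    become \<open>T (T f)\<close>.\<close>
  have *: "(T f \<cdot> \<gamma> f) \<cdot> \<beta> f = T (R_obj f) \<cdot> \<beta> f"
    by (simp add: \<gamma>_def \<beta>_props(6) \<nu>_props(5))
  show "T f \<cdot> \<gamma> f = T (R_obj f)"
    by (rule iso_cancel_right[OF _ _ _ _ _ *]) (simp_all add: \<gamma>_def)
  \<comment> \<open>Since \<open>S (R_obj f) \<cdot> arr_map M (\<alpha> f)\<close> equals
    \<open>\<beta> f \<cdot> S (T f)\<close>, this reduces the claim to the defining equation of
    \<open>\<nu> f\<close> on \<open>S (T f)\<close>.\<close>
  have "inv_arrow C (\<beta> f) \<cdot> (\<beta> f \<cdot> S (T f)) = S (T f)"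
    by (simp add: Comp_reduce[OF inv_arrow_simps(4)])
  then show "\<gamma> f \<cdot> (S (R_obj f) \<cdot> arr_map M (\<alpha> f)) = \<iota> (J f)"
    by (simp add: \<gamma>_def \<beta>_props(5) \<nu>_props(4))
qed

lemmas \<gamma>_arr [simp] = \<gamma>_props(1-3)
lemmas \<gamma>_S = \<gamma>_props(4)
lemmas T_\<gamma> = \<gamma>_props(5)

text \<open>A variant of \<open>J_eqI\<close> matching the shape of \<open>\<gamma>_S\<close>:
  composing with the invertible \<open>arr_map M (\<alpha> f)\<close> loses no information.\<close>

lemma JR_eqI:
  assumes "f \<in> Arr C" "g \<in> Arr C" "x \<in> Arr C" "y \<in> Arr C"
    "Dom C x = J (R_obj f)" "Dom C y = J (R_obj f)" "Cod C x = J g" "Cod C y = J g"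
    "x \<cdot> (S (R_obj f) \<cdot> arr_map M (\<alpha> f)) = y \<cdot> (S (R_obj f) \<cdot> arr_map M (\<alpha> f))"
    "T g \<cdot> x = T g \<cdot> y"
  shows "x = y"
proof (rule J_eqI[of "R_obj f" g])
  show "x \<cdot> S (R_obj f) = y \<cdot> S (R_obj f)"
    by (rule iso_cancel_right[OF iso_M_\<alpha>[of f]]) (use assms in simp_all)
qed (use assms in simp_all)

lemma \<mu>_top_props:
  assumes f [simp]: "f \<in> Arr C"
  shows "\<mu>_top f \<in> Arr C" "Dom C (\<mu>_top f) = E (R_obj f)" "Cod C (\<mu>_top f) = E f"
    "\<mu>_top f \<cdot> L (R_obj f) = Id C (E f)" "\<mu>_top f \<cdot> \<alpha> (R_obj f) = \<alpha> f \<cdot> \<gamma> f"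
    "R_obj f \<cdot> \<mu>_top f = R_obj (R_obj f)"
proof -
  \<comment> \<open>This is the cocone condition for \<open>\<mu>_top f\<close>. After composition
    with \<open>arr_map M (\<alpha> f)\<close>, both sides are
    \<open>\<alpha> f \<cdot> \<iota> (J f)\<close>, by naturality of \<open>\<iota>\<close> and by
    \<open>\<gamma>_S\<close>.\<close>
  have "\<iota> (E f) = (\<alpha> f \<cdot> \<gamma> f) \<cdot> S (R_obj f)"
    by (rule iso_cancel_right[OF iso_M_\<alpha>[of f]]) (simp_all add: \<gamma>_S iota_M)
  then have "Id C (E f) \<cdot> \<iota> (Dom C (R_obj f)) = (\<alpha> f \<cdot> \<gamma> f) \<cdot> S (R_obj f)" by simp
  note * = E_the[OF _ _ _ _ _ _ _ this, of "E f"]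
  show [simp]: "\<mu>_top f \<in> Arr C" "Dom C (\<mu>_top f) = E (R_obj f)" "Cod C (\<mu>_top f) = E f"
    and 1: "\<mu>_top f \<cdot> L (R_obj f) = Id C (E f)" and 2: "\<mu>_top f \<cdot> \<alpha> (R_obj f) = \<alpha> f \<cdot> \<gamma> f"
    using * by (simp_all add: \<mu>_top_def \<gamma>_def[symmetric])
  show "R_obj f \<cdot> \<mu>_top f = R_obj (R_obj f)"
    by (rule E_eqI[of "R_obj f"]) (simp_all add: 1 2 R_L R_\<alpha> Comp_reduce[OF R_\<alpha>] T_\<gamma>)
qed

lemmas \<mu>_top_arr [simp] = \<mu>_top_props(1-3)
lemmas \<mu>_L = \<mu>_top_props(4)
lemmas \<mu>_\<alpha> = \<mu>_top_props(5)
lemmas R_\<mu> = \<mu>_top_props(6)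

section \<open>Functoriality of \<open>J\<close>, \<open>E\<close> and \<open>R\<close>\<close>

lemma Jmap_Id:
  assumes f [simp]: "f \<in> Arr C"
  shows "Jmap (Square f f (Id C (Dom C f)) (Id C (Cod C f))) = Id C (J f)"
proof -
  have sq: "Square f f (Id C (Dom C f)) (Id C (Cod C f)) \<in> Arr AC"
    by (simp add: Square_in_Arr_iff)
  show ?thesis
    by (rule J_eqI[of f f]) (simp_all add: Jmap_props[OF sq])
qed

lemma Emap_Id:
  assumes f [simp]: "f \<in> Arr C"
  shows "Emap (Square f f (Id C (Dom C f)) (Id C (Cod C f))) = Id C (E f)"
proof -
  have sq: "Square f f (Id C (Dom C f)) (Id C (Cod C f)) \<in> Arr AC"
    by (simp add: Square_in_Arr_iff)
  show ?thesis
    by (rule E_eqI[of f]) (simp_all add: Emap_props[OF sq] Jmap_Id)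
qed

lemma SquareE:
  assumes "Square f g h k \<in> Arr AC"
  shows "f \<in> Arr C" "g \<in> Arr C" "h \<in> Arr C" "k \<in> Arr C"
     "Dom C h = Dom C f" "Cod C h = Dom C g" "Dom C k = Cod C f" "Cod C k = Cod C g"
     "k \<cdot> f = g \<cdot> h"
  using assms by (simp_all add: Square_in_Arr_iff)

lemma Square_Comp:
  assumes "Square f g h k \<in> Arr AC" "Square g g' h' k' \<in> Arr AC"
  shows "Square f g' (h' \<cdot> h) (k' \<cdot> k) \<in> Arr AC"
  using category.Comp_in_hom[OF category_arrow_category, of "Square f g h k" f g "Square g g' h' k'" g']
    assms by (simp add: hom_iff)

lemma Jmap_Comp:
  assumes "Square f g h k \<in> Arr AC" "Square g g' h' k' \<in> Arr AC"
  shows "Jmap (Square f g' (h' \<cdot> h) (k' \<cdot> k)) = Jmap (Square g g' h' k') \<cdot> Jmap (Square f g h k)"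
proof -
  note sq = assms Square_Comp[OF assms]
  note [simp] = sq[THEN Jmap_arr(1)] sq[THEN Jmap_arr(2)] sq[THEN Jmap_arr(3)]
    SquareE(1-8)[OF assms(1)] SquareE(1-8)[OF assms(2)]
  note rules = sq[THEN Jmap_S] sq[THEN T_Jmap]
  show ?thesis
    by (rule J_eqI[of f g']) (simp_all add: rules rules[THEN Comp_reduce] M_Comp)
qed

lemma Emap_Comp:
  assumes "Square f g h k \<in> Arr AC" "Square g g' h' k' \<in> Arr AC"
  shows "Emap (Square f g' (h' \<cdot> h) (k' \<cdot> k)) = Emap (Square g g' h' k') \<cdot> Emap (Square f g h k)"
proof -
  note sq = assms Square_Comp[OF assms]
  note [simp] = sq[THEN Jmap_arr(1)] sq[THEN Jmap_arr(2)] sq[THEN Jmap_arr(3)]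
    sq[THEN Emap_arr(1)] sq[THEN Emap_arr(2)] sq[THEN Emap_arr(3)]
    SquareE(1-8)[OF assms(1)] SquareE(1-8)[OF assms(2)]
  note rules = sq[THEN Emap_L] sq[THEN Emap_\<alpha>]
  show ?thesis
    by (rule E_eqI[of f]) (simp_all add: rules rules[THEN Comp_reduce] Jmap_Comp[OF assms])
qed

lemma R_simps [simp]:
  "obj_map R f = R_obj f"
  "arr_map R (Square f g h k) = Square (R_obj f) (R_obj g) (Emap (Square f g h k)) k"
  by (simp_all add: R_def)

lemma R_square:
  assumes "Square f g h k \<in> Arr AC"
  shows "Square (R_obj f) (R_obj g) (Emap (Square f g h k)) k \<in> Arr AC"
  using SquareE[OF assms] Emap_props[OF assms] by (simp add: Square_in_Arr_iff)

lemma functor_R: "functor_between AC AC R"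
proof -
  interpret AC: category AC by (rule category_arrow_category)
  show ?thesis
  proof (unfold_locales, goal_cases)
    case (1 f) then show ?case by simp
  next
    case (2 \<sigma> f g) then show ?case by (cases \<sigma>) (auto simp: hom_iff R_square)
  next
    case (3 f) then show ?case by (simp add: Emap_Id)
  next
    case (4 \<sigma> f g \<tau> k)
    then show ?case by (cases \<sigma>; cases \<tau>) (auto simp: hom_iff Emap_Comp)
  qed
qed

lemma functor_id: "functor_between AC AC id_fmap"
proof -
  interpret AC: category AC by (rule category_arrow_category)
  show ?thesis by unfold_locales (simp_all add: id_fmap_def)
qed

lemma functor_RR: "functor_between AC AC (comp_fmap R R)"
proof -
  interpret R: functor_between AC AC R by (rule functor_R)
  show ?thesis
  proof (unfold_locales, goal_cases)
    case 1 then show ?case using R.obj_map_in_Obj by (simp add: comp_fmap_def)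
  next
    case 2 then show ?case using R.arr_map_in_hom by (simp add: comp_fmap_def del: R_simps)
  next
    case 3 then show ?case
      using R.arr_map_Id R.obj_map_in_Obj by (simp add: comp_fmap_def del: R_simps arrow_category_simps(4))
  next
    case (4 \<sigma> f g \<tau> k) then show ?case
      using R.arr_map_Comp[OF 4] R.arr_map_Comp[OF 4[THEN R.arr_map_in_hom]]
      by (simp add: comp_fmap_def del: R_simps arrow_category_simps)
  qed
qed

section \<open>Naturality of the unit and the multiplication\<close>

lemma \<eta>_square: "f \<in> Arr C \<Longrightarrow> Square f (R_obj f) (L f) (Id C (Cod C f)) \<in> Arr AC"
  by (simp add: Square_in_Arr_iff R_L)

lemma \<mu>_square:
  "f \<in> Arr C \<Longrightarrow> Square (R_obj (R_obj f)) (R_obj f) (\<mu>_top f) (Id C (Cod C f)) \<in> Arr AC"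
  by (simp add: Square_in_Arr_iff R_\<mu>)

lemma \<eta>_natural: "natural_transformation AC AC id_fmap R \<eta>"
proof -
  interpret I: functor_between AC AC id_fmap by (rule functor_id)
  interpret R: functor_between AC AC R by (rule functor_R)
  show ?thesis
  proof (unfold_locales, goal_cases)
    case (1 f) then show ?case by (simp add: \<eta>_def id_fmap_def hom_iff \<eta>_square)
  next
    case (2 \<sigma> f g)
    then obtain h k where \<sigma>: "\<sigma> = Square f g h k" and sq: "Square f g h k \<in> Arr AC"
      by (cases \<sigma>) (auto simp: hom_iff)
    show ?case
      using SquareE[OF sq] by (simp add: \<sigma> id_fmap_def \<eta>_def Emap_L[OF sq])
  qed
qed

text \<open>Tested as in \<open>JR_eqI\<close>, both sides give
  \<open>Jmap (Square f g h k) \<cdot> \<iota> (J f)\<close> on the \<open>S\<close> side, by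
  naturality of \<open>\<iota>\<close>, and \<open>k \<cdot> T (R_obj f)\<close> on the
  \<open>T\<close> side.\<close>

lemma \<gamma>_natural:
  assumes sq: "Square f g h k \<in> Arr AC"
  shows "\<gamma> g \<cdot> Jmap (Square (R_obj f) (R_obj g) (Emap (Square f g h k)) k) =
    Jmap (Square f g h k) \<cdot> \<gamma> f"
proof -
  let ?\<sigma> = "Square f g h k"
  note sqs = sq R_square[OF sq]
  note [simp] = SquareE(1-8)[OF sq] sqs[THEN Jmap_arr(1)] sqs[THEN Jmap_arr(2)] sqs[THEN Jmap_arr(3)]
    Emap_arr[OF sq]
  have M\<alpha>: "arr_map M (Emap ?\<sigma>) \<cdot> arr_map M (\<alpha> f) = arr_map M (\<alpha> g) \<cdot> arr_map M (Jmap ?\<sigma>)"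
    using Emap_\<alpha>[OF sq] by (simp flip: M_Comp)
  \<comment> \<open>The left side of \<open>\<gamma>_S\<close> has three factors, so its
    \<open>Comp_reduce\<close> form is not fully nested to the right; this restates it in that
    normal form.\<close>
  have \<gamma>_S': "\<gamma> g \<cdot> (S (R_obj g) \<cdot> (arr_map M (\<alpha> g) \<cdot> w)) = \<iota> (J g) \<cdot> w"
    if "w \<in> Arr C" "Cod C w = obj_map M (J g)" for w
    using Comp_reduce[OF \<gamma>_S, of g w] that by simp
  note rules = sqs[THEN Jmap_S] sqs[THEN T_Jmap] \<gamma>_S[OF SquareE(1)[OF sq]] T_\<gamma>
  show ?thesis
    by (rule JR_eqI[of f g])
      (simp_all add: rules rules[THEN Comp_reduce] M\<alpha> \<gamma>_S' iota_M)
qed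

lemma \<mu>_natural: "natural_transformation AC AC (comp_fmap R R) R \<mu>"
proof -
  interpret I: functor_between AC AC "comp_fmap R R" by (rule functor_RR)
  interpret R: functor_between AC AC R by (rule functor_R)
  show ?thesis
  proof (unfold_locales, goal_cases)
    case (1 f) then show ?case by (simp add: \<mu>_def comp_fmap_def hom_iff \<mu>_square)
  next
    case (2 \<sigma> f g)
    then obtain h k where \<sigma>: "\<sigma> = Square f g h k" and sq: "Square f g h k \<in> Arr AC"
      by (cases \<sigma>) (auto simp: hom_iff)
    let ?\<tau> = "Square (R_obj f) (R_obj g) (Emap (Square f g h k)) k"
    note sqs = sq R_square[OF sq]
    note [simp] = SquareE(1-8)[OF sq] sqs[THEN Jmap_arr(1)] sqs[THEN Jmap_arr(2)] sqs[THEN Jmap_arr(3)]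
      sqs[THEN Emap_arr(1)] sqs[THEN Emap_arr(2)] sqs[THEN Emap_arr(3)]
    note rules = sqs[THEN Emap_L] sqs[THEN Emap_\<alpha>] \<mu>_L \<mu>_\<alpha>
    \<comment> \<open>On \<open>L (R_obj f)\<close> both sides reduce to
      \<open>Emap (Square f g h k)\<close>; on \<open>\<alpha> (R_obj f)\<close> the equation is
      \<open>\<gamma>_natural\<close> composed with \<open>\<alpha> g\<close>.\<close>
    have "\<mu>_top g \<cdot> Emap ?\<tau> = Emap (Square f g h k) \<cdot> \<mu>_top f"
      by (rule E_eqI[of "R_obj f"])
        (simp_all add: rules rules[THEN Comp_reduce] \<gamma>_natural[OF sq])
    then show ?case by (simp add: \<sigma> comp_fmap_def \<mu>_def)
  qed
qed

section \<open>The monad laws\<close>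

lemma \<mu>_top_Emap_\<eta>:
  assumes f [simp]: "f \<in> Arr C"
  shows "\<mu>_top f \<cdot> Emap (\<eta> f) = Id C (E f)"
proof -
  note sq = \<eta>_square[OF f]
  note [simp] = Jmap_arr[OF sq, folded \<eta>_def] Emap_arr[OF sq, folded \<eta>_def]
  note rules = Emap_L[OF sq, folded \<eta>_def] Emap_\<alpha>[OF sq, folded \<eta>_def]
    Jmap_S[OF sq, folded \<eta>_def] T_Jmap[OF sq, folded \<eta>_def] \<mu>_L \<mu>_\<alpha> T_\<gamma> \<gamma>_S
  have M_L: "arr_map M (L f) \<cdot> arr_map M (\<iota> (Dom C f)) = arr_map M (\<alpha> f) \<cdot> arr_map M (S f)"
    using L_\<iota>[OF f] by (simp flip: M_Comp)
  have \<gamma>_S': "\<gamma> f \<cdot> (S (R_obj f) \<cdot> (arr_map M (\<alpha> f) \<cdot> w)) = \<iota> (J f) \<cdot> w"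
    if "w \<in> Arr C" "Cod C w = obj_map M (J f)" for w
    using Comp_reduce[OF \<gamma>_S, of f w] that by simp
  \<comment> \<open>Composing with the invertible \<open>arr_map M (\<iota> (Dom C f))\<close> turns
    \<open>L f\<close> into \<open>\<alpha> f\<close>, so the left side becomes
    \<open>S f \<cdot> \<iota> (obj_map M (Dom C f))\<close>. \<open>M_iota\<close> enters only in
    the second pass, since rewriting \<open>arr_map M (\<iota> (Dom C f))\<close> earlier would
    block \<open>M_L\<close>.\<close>
  have "\<gamma> f \<cdot> (S (R_obj f) \<cdot> arr_map M (L f)) = S f"
    by (rule iso_cancel_right[OF iso_M_iota[of "Dom C f"]])
      (simp_all add: M_L \<gamma>_S' iota_M, simp_all add: M_iota)
  note rules = this rules
  have "\<gamma> f \<cdot> Jmap (\<eta> f) = Id C (J f)"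
    by (rule J_eqI[of f f]) (simp_all add: rules rules[THEN Comp_reduce])
  note rules = this rules
  show ?thesis
    by (rule E_eqI[of f]) (simp_all add: rules rules[THEN Comp_reduce])
qed

lemma \<mu>_top_Emap_\<mu>:
  assumes f [simp]: "f \<in> Arr C"
  shows "\<mu>_top f \<cdot> Emap (\<mu> f) = \<mu>_top f \<cdot> \<mu>_top (R_obj f)"
proof -
  note sq = \<mu>_square[OF f]
  note [simp] = Jmap_arr[OF sq, folded \<mu>_def] Emap_arr[OF sq, folded \<mu>_def]
  note rules = Emap_L[OF sq, folded \<mu>_def] Emap_\<alpha>[OF sq, folded \<mu>_def]
    Jmap_S[OF sq, folded \<mu>_def] T_Jmap[OF sq, folded \<mu>_def] \<mu>_L \<mu>_\<alpha> T_\<gamma> \<gamma>_S[of "R_obj f"]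
  have M_\<mu>: "arr_map M (\<mu>_top f) \<cdot> arr_map M (\<alpha> (R_obj f)) = arr_map M (\<alpha> f) \<cdot> arr_map M (\<gamma> f)"
    using \<mu>_\<alpha>[OF f] by (simp flip: M_Comp)
  have \<gamma>_S': "\<gamma> f \<cdot> (S (R_obj f) \<cdot> (arr_map M (\<alpha> f) \<cdot> w)) = \<iota> (J f) \<cdot> w"
    if "w \<in> Arr C" "Cod C w = obj_map M (J f)" for w
    using Comp_reduce[OF \<gamma>_S, of f w] that by simp
  \<comment> \<open>On the \<open>S\<close> side both composites equal
    \<open>\<gamma> f \<cdot> \<iota> (J (R_obj f))\<close>: on the left, \<open>M_\<mu>\<close> and
    \<open>\<gamma>_S'\<close> produce \<open>\<iota> (J f) \<cdot> arr_map M (\<gamma> f)\<close>,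
    and \<open>\<iota>\<close> is natural.\<close>
  have "\<gamma> f \<cdot> Jmap (\<mu> f) = \<gamma> f \<cdot> \<gamma> (R_obj f)"
    by (rule JR_eqI[of "R_obj f" f])
      (simp_all add: rules rules[THEN Comp_reduce] M_\<mu> \<gamma>_S' iota_M)
  note rules = this rules
  show ?thesis
    by (rule E_eqI[of "R_obj (R_obj f)"]) (simp_all add: rules rules[THEN Comp_reduce])
qed

lemma monad_R: "monad AC R \<eta> \<mu>"
proof (intro monad.intro monad_axioms.intro category_arrow_category functor_R \<eta>_natural \<mu>_natural,
    goal_cases)
  \<comment> \<open>The left unit law is the prescribed value of \<open>\<mu>_top f\<close> on
    \<open>L (R_obj f)\<close>.\<close>
  case (1 f) then show ?case by (simp add: \<mu>_def \<eta>_def \<mu>_L)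
next
  case (2 f) then show ?case using \<mu>_top_Emap_\<eta>[of f] by (simp add: \<mu>_def \<eta>_def)
next
  case (3 f) then show ?case using \<mu>_top_Emap_\<mu>[of f] by (simp add: \<mu>_def)
qed

end

theorem theorem19:
  fixes C :: "('o, 'a, 'm) cat_scheme"
    and po :: "'a \<Rightarrow> 'a \<Rightarrow> 'a \<times> 'a"
    and \<E> \<M> :: "'a set"
    and fac :: "'a \<Rightarrow> 'a \<times> 'a"
    and M :: "('o, 'a, 'o, 'a) fmap"
    and \<iota> :: "'o \<Rightarrow> 'a"
  assumes "category C"
    and "chosen_pushouts C po"
    and "orthogonal_factorisation_system C \<E> \<M>"
    and "chosen_factorisations C \<E> \<M> fac"
    and "idempotent_comonad C M \<iota>"
    and "preserves_pushouts C C M"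
  shows "monad (arrow_category C)
    (monad_construction.R C po fac M \<iota>)
    (monad_construction.\<eta> C po fac \<iota>)
    (monad_construction.\<mu> C po fac M \<iota>)"
  using comonad_factorisation.monad_R[of C po fac M \<iota> \<E> \<M>] assms
  by (simp add: comonad_factorisation_def comonad_factorisation_axioms_def)

end
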